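(* Let $\varepsilon>0$ and let $\mathcal{F}\subseteq[\mathcal{C}]^{<\omega}$ be an $\varepsilon$-filling family over the Cantor set $\mathcal{C}=2^\omega$. If $\mathcal{F}$ has the Galvin property, then for every perfect subset $P$ of $\mathcal{C}$ there exists a perfect $Q\subseteq P$ such that $[Q]^{<\omega}\subseteq\mathcal{F}$.
   Context: $\mathcal{C}=2^\omega$ is the Cantor set and $<$ is its strict lexicographical ordering; for $A,B\subseteq\mathcal{C}$, $A<B$ means $x<y$ for all $x\in A$, $y\in B$. For $P\subseteq\mathcal{C}$ and $k\geq 1$, $[P]^k$ is the set of all $k$-element subsets of $P$, identified with the $<$-increasing sequences of length $k$ in $P$, and $[P]^{<\omega}=\bigcup_{k\geq1}[P]^k$ (the empty set plays no role). In particular, if $P_0<\dots<P_n$, then $P_0\times\dots\times P_n$ is regarded as a subset of $[\mathcal{C}]^{n+1}$. Perfect means nonempty, closed and without isolated points. A family $\mathcal{F}\subseteq[\mathcal{C}]^{<\omega}$ is hereditary if every (nonempty) subset of a member of $\mathcal{F}$ belongs to $\mathcal{F}$. It is $\varepsilon$-filling over $\mathcal{C}$ if it is hereditary and for every $F\in[\mathcal{C}]^{<\omega}$ there is $G\subseteq F$ with $G\in\mathcal{F}$ and $|G|\geq\varepsilon|F|$. A family $\mathcal{F}\subseteq[\mathcal{C}]^{<\omega}$ has the Galvin property if for every $n\in\omega$ and all perfect subsets $P_0<\dots<P_n$ of $\mathcal{C}$ there exist $Q_0,\dots,Q_n$ such that $Q_i$ is a perfect subset of $P_i$ for each $i=0,\dots,n$,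 and either $Q_0\times\dots\times Q_n\subseteq\mathcal{F}$ or $(Q_0\times\dots\times Q_n)\cap\mathcal{F}=\varnothing$. *)

theory Defs
  imports
    "HOL-Analysis.Analysis"
    "HOL-Library.Fun_Lexorder"
    "HOL-Library.Ramsey"
begin

text \<open>
  The class topology on this type is the product of the discrete topologies.  The class order
  \<open><\<close> on it is pointwise and is never used here; the strict lexicographic order is
  \<^const>\<open>less_fun\<close>.
\<close>
type_synonym cantor = "nat \<Rightarrow> bool"

definition perfect_set :: "'a::topological_space set \<Rightarrow> bool" where
  "perfect_set P \<longleftrightarrow> P \<noteq> {} \<and> closed P \<and> (\<forall>x\<in>P. \<not> x isolated_in P)"

definition lex_below :: "cantor set \<Rightarrow> cantor set \<Rightarrow> bool" where
  "lex_below A B \<longleftrightarrow> (\<forall>x\<in>A. \<forall>y\<in>B. less_fun x y)"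

definition fin_subsets :: "'a set \<Rightarrow> 'a set set" where
  "fin_subsets P = (\<Union>k\<in>{1..}. nsets P k)"

lemma mem_fin_subsets_iff: "F \<in> fin_subsets P \<longleftrightarrow> F \<subseteq> P \<and> finite F \<and> F \<noteq> {}"
  by (auto simp: fin_subsets_def nsets_def Suc_le_eq card_gt_0_iff)

definition hereditary :: "'a set set \<Rightarrow> bool" where
  "hereditary \<F> \<longleftrightarrow> (\<forall>F\<in>\<F>. \<forall>G. G \<subseteq> F \<and> G \<noteq> {} \<longrightarrow> G \<in> \<F>)"

definition filling :: "real \<Rightarrow> cantor set set \<Rightarrow> bool" where
  "filling \<epsilon> \<F> \<longleftrightarrow> hereditary \<F> \<and>
     (\<forall>F\<in>fin_subsets UNIV. \<exists>G\<subseteq>F. G \<in> \<F> \<and> real (card G) \<ge> \<epsilon> * real (card F))"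

text \<open>
  The product \<open>P 0 \<times> \<dots> \<times> P n\<close>, each sequence being identified with the set of its terms.
  This loses nothing when \<open>P 0 < \<dots> < P n\<close>, as the terms of a sequence are then increasing.
\<close>
definition set_product :: "nat \<Rightarrow> (nat \<Rightarrow> 'a set) \<Rightarrow> 'a set set" where
  "set_product n P = (\<lambda>x. x ` {..n}) ` (\<Pi>\<^sub>E i\<in>{..n}. P i)"

lemma set_product_subset_nsets:
  assumes "\<And>i j. i < j \<Longrightarrow> j \<le> n \<Longrightarrow> lex_below (P i) (P j)"
  shows "set_product n P \<subseteq> nsets UNIV (n + 1)"
proof -
  have "card (x ` {..n}) = n + 1" if x: "x \<in> (\<Pi>\<^sub>E i\<in>{..n}. P i)" for x
  proof -
    have "x i \<noteq> x j" if "i < j" "j \<le> n" for i j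
    proof -
      have "less_fun (x i) (x j)"
        using assms[OF that] x that by (auto simp: lex_below_def PiE_def Pi_def)
      then show ?thesis using less_fun_irrefl by metis
    qed
    then have "inj_on x {..n}"
      by (intro inj_onI) (metis atMost_iff linorder_neqE_nat)
    then show ?thesis by (simp add: card_image)
  qed
  then show ?thesis by (auto simp: set_product_def nsets_def)
qed

definition galvin_property :: "cantor set set \<Rightarrow> bool" where
  "galvin_property \<F> \<longleftrightarrow>
     (\<forall>(n::nat) P. (\<forall>i\<le>n. perfect_set (P i)) \<and> (\<forall>i j. i < j \<and> j \<le> n \<longrightarrow> lex_below (P i) (P j)) \<longrightarrow>
       (\<exists>Q. (\<forall>i\<le>n. perfect_set (Q i) \<and> Q i \<subseteq> P i) \<and>
            (set_product n Q \<subseteq> \<F> \<or> set_product n Q \<inter> \<F> = {})))"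

end

theory Submission
  imports Defs
begin

text \<open>
  Applying the Galvin property to all nonempty subsets of each level yields a Cantor scheme of
  perfect sets below \<open>P\<close> such that, for every set \<open>S\<close> of nodes of one level, either all
  transversals of \<open>S\<close> belong to \<open>\<F>\<close> or none does.  Pick one point below each node of level \<open>j\<close>;
  since \<open>\<F>\<close> is filling, a proportion \<open>\<epsilon>\<close> of these \<open>2 ^ j\<close> points forms a member \<open>G j\<close> of \<open>\<F>\<close>.
  Along a subsequence, the normalized counting measures of the \<open>G j\<close> converge on all nodes; the
  limit has mass at least \<open>\<epsilon>\<close> and is dominated by the uniform measure, so the tree of nodes of
  positive limit mass is nonempty and perfect.  Finitely many nodes of this tree on one level are
  all met by a single \<open>G j\<close>, so by heredity some, and hence every, transversal of them is in \<open>\<F>\<close>.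
  The branches of the tree form the required perfect set.
\<close>

section \<open>Cylinders and perfect sets\<close>

definition cylinder :: "nat \<Rightarrow> cantor \<Rightarrow> cantor set" where
  "cylinder n x = {z. \<forall>k<n. z k = x k}"

lemma self_in_cylinder [simp]: "x \<in> cylinder n x"
  by (simp add: cylinder_def)

lemma open_coordinate: "open {z :: cantor. z k = b}"
proof -
  have "open ((\<lambda>z::cantor. z k) -` {b})"
    by (intro open_vimage open_discrete) (auto intro: continuous_on_product_coordinates)
  then show ?thesis by (simp add: vimage_def)
qed

lemma open_cylinder: "open (cylinder n x)"
proof -
  have "cylinder n x = (\<Inter>k\<in>{..<n}. {z. z k = x k})"
    by (auto simp: cylinder_def)
  then show ?thesis by (auto intro: open_INT open_coordinate)
qed

lemma closed_cylinder: "closed (cylinder n x)"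
proof -
  have "- cylinder n x = (\<Union>k\<in>{..<n}. {z. z k = (\<not> x k)})"
    by (auto simp: cylinder_def)
  then show ?thesis unfolding closed_def by (auto intro: open_coordinate)
qed

text \<open>A basic open set of the product constrains only finitely many coordinates, so a cylinder
  reaching past all of them fits inside.\<close>

lemma cylinder_subset_open:
  assumes "open U" "x \<in> U"
  obtains n where "cylinder n x \<subseteq> U"
proof -
  obtain X where X: "x \<in> Pi\<^sub>E UNIV X" "finite {i. X i \<noteq> UNIV}" "Pi\<^sub>E UNIV X \<subseteq> U"
    using product_topology_open_contains_basis[of "\<lambda>_. euclidean" UNIV U x] assms
    by (auto simp: open_fun_def)
  obtain n where n: "\<forall>i\<in>{i. X i \<noteq> UNIV}. i < n"
    using finite_nat_set_iff_bounded X(2) by blast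
  have "z i \<in> X i" if "z \<in> cylinder n x" for z i
    using that n X(1) by (cases "X i = UNIV") (auto simp: cylinder_def PiE_def)
  then have "cylinder n x \<subseteq> U"
    using X(3) by (auto simp: PiE_def)
  then show thesis using that by blast
qed

text \<open>Cylinders form a neighbourhood basis, so isolation can be tested on them; later
  arguments then only compare coordinates.\<close>

lemma perfect_set_cylinder_iff:
  "perfect_set P \<longleftrightarrow> P \<noteq> {} \<and> closed P \<and> (\<forall>x\<in>P. \<forall>n. \<exists>y\<in>P \<inter> cylinder n x. y \<noteq> x)"
proof -
  have "\<not> x isolated_in P \<longleftrightarrow> (\<forall>n. \<exists>y\<in>P \<inter> cylinder n x. y \<noteq> x)" if "x \<in> P" for x
  proof
    assume L: "\<not> x isolated_in P"
    show "\<forall>n. \<exists>y\<in>P \<inter> cylinder n x. y \<noteq> x"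
    proof (rule ccontr)
      assume "\<not> ?thesis"
      then obtain n where "\<forall>y\<in>P \<inter> cylinder n x. y = x"
        by auto
      then have "cylinder n x \<inter> P = {x}"
        using that by auto
      with L that open_cylinder show False
        by (auto simp: isolated_in_def)
    qed
  next
    assume R: "\<forall>n. \<exists>y\<in>P \<inter> cylinder n x. y \<noteq> x"
    show "\<not> x isolated_in P"
    proof
      assume "x isolated_in P"
      then obtain U where U: "open U" "U \<inter> P = {x}"
        by (auto simp: isolated_in_def)
      then obtain n where "cylinder n x \<subseteq> U"
        by (metis Int_iff cylinder_subset_open insertI1)
      then show False using R U by blast
    qed
  qed
  then show ?thesis by (auto simp: perfect_set_def)
qed

lemma perfect_set_Int_cylinder:
  assumes "perfect_set P" "x \<in> P"
  shows "perfect_set (P \<inter> cylinder n x)"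
  unfolding perfect_set_cylinder_iff
proof (intro conjI ballI allI)
  show "P \<inter> cylinder n x \<noteq> {}" using assms by auto
  show "closed (P \<inter> cylinder n x)"
    using assms by (auto simp: perfect_set_def closed_cylinder)
  fix z m assume z: "z \<in> P \<inter> cylinder n x"
  \<comment> \<open>Length \<open>max m n\<close> serves both cylinders at once, since
    \<open>z\<close> already agrees with \<open>x\<close> below \<open>n\<close>.\<close>
  with assms obtain y where y: "y \<in> P \<inter> cylinder (max m n) z" "y \<noteq> z"
    unfolding perfect_set_cylinder_iff by blast
  then show "\<exists>y\<in>P \<inter> cylinder n x \<inter> cylinder m z. y \<noteq> z"
    using z by (intro bexI[of _ y]) (auto simp: cylinder_def)
qed

text \<open>Two points of \<open>P\<close> in one cylinder of length \<open>n\<close> first differ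
  at some \<open>k\<close>. Fixing the coordinates up to \<open>k\<close> around each of them gives
  two pieces that agree below \<open>k\<close>, so the bit at \<open>k\<close> orders them. The
  common cylinder makes the pieces of a scheme shrink.\<close>

lemma perfect_set_split:
  assumes "perfect_set P"
  obtains Q0 Q1 x where "perfect_set Q0" "perfect_set Q1"
    "Q0 \<subseteq> P \<inter> cylinder n x" "Q1 \<subseteq> P \<inter> cylinder n x" "lex_below Q0 Q1"
proof -
  obtain x where x: "x \<in> P" using assms by (auto simp: perfect_set_def)
  then obtain y where y: "y \<in> P \<inter> cylinder n x" "y \<noteq> x"
    using assms unfolding perfect_set_cylinder_iff by blast
  define k where "k = (LEAST k. y k \<noteq> x k)"
  have "\<exists>k. y k \<noteq> x k" using y(2) by auto
  then have k: "y k \<noteq> x k" unfolding k_def by (rule LeastI_ex)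
  have less_k: "y i = x i" if "i < k" for i
    using not_less_Least[of i "\<lambda>k. y k \<noteq> x k"] that unfolding k_def by blast
  have "n \<le> k"
    using k y(1) by (auto simp: cylinder_def not_less[symmetric])
  have sub: "P \<inter> cylinder (Suc k) z \<subseteq> P \<inter> cylinder n x" if "z \<in> {x, y}" for z
    using that y(1) \<open>n \<le> k\<close> by (auto simp: cylinder_def)
  have perf: "perfect_set (P \<inter> cylinder (Suc k) z)" if "z \<in> {x, y}" for z
    using that x y(1) assms by (auto intro!: perfect_set_Int_cylinder)
  \<comment> \<open>\<open>u\<close> and \<open>v\<close> are \<open>x\<close> and \<open>y\<close>,
    named so that the one with bit \<open>False\<close> at \<open>k\<close> comes first.\<close>
  have lex: "lex_below (P \<inter> cylinder (Suc k) u) (P \<inter> cylinder (Suc k) v)"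
    if "{u, v} = {x, y}" "\<not> u k" "v k" for u v
    unfolding lex_below_def less_fun_def
  proof (intro ballI exI[of _ k] conjI allI impI)
    fix a b assume ab: "a \<in> P \<inter> cylinder (Suc k) u" "b \<in> P \<inter> cylinder (Suc k) v"
    show "a k < b k" using ab that by (auto simp: cylinder_def)
    fix i assume "i < k"
    then show "a i = b i"
      using ab that less_k by (auto simp: cylinder_def doubleton_eq_iff)
  qed
  show thesis
  proof (cases "x k")
    case True
    then show thesis
      using k by (intro that[OF perf[of y] perf[of x] sub[of y] sub[of x] lex[of y x]]) auto
  next
    case False
    then show thesis
      using k by (intro that[OF perf[of x] perf[of y] sub[of x] sub[of y] lex[of x y]]) auto
  qed
qed

section \<open>Compactness of the Cantor set\<close>

lemma compact_UNIV_cantor: "compact (UNIV :: cantor set)"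
proof -
  have "compact_space (product_topology (\<lambda>_::nat. euclidean :: bool topology) UNIV)"
    unfolding compact_space_product_topology
    by (auto simp: compact_space_def compactin_euclidean_iff intro: finite_imp_compact)
  then show ?thesis
    by (simp add: euclidean_product_topology compact_space_def compactin_euclidean_iff)
qed

text \<open>Any finitely many of the sets contain a later one, which is nonempty; compactness does
  the rest.\<close>

lemma cantor_nested_Inter_nonempty:
  fixes F :: "nat \<Rightarrow> cantor set"
  assumes "\<And>n. closed (F n)" "\<And>n. F n \<noteq> {}" "\<And>n. F (Suc n) \<subseteq> F n"
  shows "(\<Inter>n. F n) \<noteq> {}"
proof -
  have anti: "F n \<subseteq> F m" if "m \<le> n" for m n
    using lift_Suc_antimono_le[of F, OF assms(3) that] .
  have "UNIV \<inter> (\<Inter>n\<in>UNIV. F n) \<noteq> {}"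
  proof (rule compact_imp_fip_image[OF compact_UNIV_cantor])
    fix I :: "nat set" assume "finite I"
    then obtain N where "\<forall>i\<in>I. i \<le> N"
      using finite_nat_set_iff_bounded_le by blast
    then have "F N \<subseteq> UNIV \<inter> (\<Inter>i\<in>I. F i)"
      using anti by blast
    then show "UNIV \<inter> (\<Inter>i\<in>I. F i) \<noteq> {}" using assms(2)[of N] by blast
  qed (use assms(1) in auto)
  then show ?thesis by simp
qed

section \<open>Galvin schemes\<close>

text \<open>The Galvin alternative for factors indexed by an arbitrary set \<open>S\<close>, so that
  nodes keep their codes; only the values of \<open>x\<close> on \<open>S\<close> matter.\<close>

definition decided :: "cantor set set \<Rightarrow> (nat \<Rightarrow> cantor set) \<Rightarrow> nat set \<Rightarrow> bool" where
  "decided \<F> P S \<longleftrightarrow>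
     (\<forall>x. (\<forall>i\<in>S. x i \<in> P i) \<longrightarrow> x ` S \<in> \<F>) \<or> (\<forall>x. (\<forall>i\<in>S. x i \<in> P i) \<longrightarrow> x ` S \<notin> \<F>)"

lemma decided_mono:
  assumes "decided \<F> P S" "\<And>i. i \<in> S \<Longrightarrow> Q i \<subseteq> P i"
  shows "decided \<F> Q S"
  using assms unfolding decided_def by (meson subsetD)

lemma lex_below_mono: "lex_below A B \<Longrightarrow> A' \<subseteq> A \<Longrightarrow> B' \<subseteq> B \<Longrightarrow> lex_below A' B'"
  by (auto simp: lex_below_def)

text \<open>Numbering \<open>S\<close> increasingly by \<open>{..n}\<close> gives an instance of the
  Galvin property, whose result is carried back along the numbering. Factors outside
  \<open>S\<close> stay unchanged, which allows iteration over several \<open>S\<close>.\<close>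

lemma galvin_refine_single:
  assumes "galvin_property \<F>" "finite S" "S \<noteq> {}"
    and perf: "\<And>i. i \<in> S \<Longrightarrow> perfect_set (P i)"
    and lex: "\<And>i j. i \<in> S \<Longrightarrow> j \<in> S \<Longrightarrow> i < j \<Longrightarrow> lex_below (P i) (P j)"
  obtains Q where "\<And>i. Q i \<subseteq> P i" "\<And>i. i \<in> S \<Longrightarrow> perfect_set (Q i)"
    "\<And>i. i \<notin> S \<Longrightarrow> Q i = P i" "decided \<F> Q S"
proof -
  obtain h where h: "bij_betw h {..<card S} S" "strict_mono_on {..<card S} h"
    using ex_bij_betw_strict_mono_card[OF \<open>finite S\<close>] by blast
  \<comment> \<open>The property at \<open>n\<close> concerns \<open>n + 1\<close> factors; as
    \<open>S\<close> is nonempty, the subtraction is exact.\<close>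
  define n where "n = card S - 1"
  have n: "{..<card S} = {..n}"
    using assms(2,3) by (simp add: n_def card_gt_0_iff flip: lessThan_Suc_atMost)
  note h = h[unfolded n]
  have hS: "h i \<in> S" if "i \<le> n" for i
    using h(1) that by (auto simp: bij_betw_def)
  have "\<exists>Q. (\<forall>i\<le>n. perfect_set (Q i) \<and> Q i \<subseteq> P (h i)) \<and>
            (set_product n Q \<subseteq> \<F> \<or> set_product n Q \<inter> \<F> = {})"
  proof (rule assms(1)[unfolded galvin_property_def, rule_format])
    show "(\<forall>i\<le>n. perfect_set (P (h i))) \<and>
      (\<forall>i j. i < j \<and> j \<le> n \<longrightarrow> lex_below (P (h i)) (P (h j)))"
      using perf lex hS h(2) by (auto simp: strict_mono_on_def)
  qed
  then obtain Q where Q: "\<And>i. i \<le> n \<Longrightarrow> perfect_set (Q i) \<and> Q i \<subseteq> P (h i)"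
    "set_product n Q \<subseteq> \<F> \<or> set_product n Q \<inter> \<F> = {}"
    by blast
  define g where "g = inv_into {..n} h"
  have g: "g i \<le> n" "h (g i) = i" if "i \<in> S" for i
    using h(1) that bij_betw_inv_into_right[OF h(1) that]
      bij_betwE[OF bij_betw_inv_into[OF h(1)]] by (auto simp: g_def)
  have gh: "g (h i) = i" if "i \<le> n" for i
    using that bij_betw_inv_into_left[OF h(1)] by (simp add: g_def)
  define R where "R i = (if i \<in> S then Q (g i) else P i)" for i
  \<comment> \<open>Composition with \<open>h\<close> reads a transversal of \<open>R\<close> as an
    element of the product; \<open>restrict\<close> makes it extensional.\<close>
  have prod: "x ` S \<in> set_product n Q" if "\<forall>i\<in>S. x i \<in> R i" for x
  proof -
    have "x ` S = restrict (x \<circ> h) {..n} ` {..n}"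
      using h(1) by (metis bij_betw_def image_comp image_restrict_eq)
    moreover have "restrict (x \<circ> h) {..n} \<in> (\<Pi>\<^sub>E i\<in>{..n}. Q i)"
    proof -
      have "x (h i) \<in> Q i" if "i \<le> n" for i
        using bspec[OF \<open>\<forall>i\<in>S. x i \<in> R i\<close> hS[OF that]] hS[OF that] gh[OF that] by (simp add: R_def)
      then show ?thesis by simp
    qed
    ultimately show ?thesis unfolding set_product_def by (rule image_eqI)
  qed
  show thesis
  proof
    show "R i \<subseteq> P i" for i using Q(1)[of "g i"] g[of i] by (cases "i \<in> S") (simp_all add: R_def)
    show "perfect_set (R i)" if "i \<in> S" for i using Q(1) g that by (simp add: R_def)
    show "R i = P i" if "i \<notin> S" for i using that by (simp add: R_def)
    show "decided \<F> R S"
      using Q(2)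
    proof
      assume "set_product n Q \<subseteq> \<F>"
      then show ?thesis using prod unfolding decided_def by blast
    next
      assume "set_product n Q \<inter> \<F> = {}"
      then show ?thesis using prod unfolding decided_def by blast
    qed
  qed
qed

text \<open>The sets \<open>S\<close> are treated one after another; by \<open>decided_mono\<close>,
  later shrinking does not undo earlier decisions.\<close>

lemma galvin_refine:
  assumes "galvin_property \<F>" "finite \<S>"
    and "\<And>S. S \<in> \<S> \<Longrightarrow> S \<noteq> {} \<and> S \<subseteq> I" "finite I"
    and "\<And>i. i \<in> I \<Longrightarrow> perfect_set (P i)"
    and lex: "\<And>i j. i \<in> I \<Longrightarrow> j \<in> I \<Longrightarrow> i < j \<Longrightarrow> lex_below (P i) (P j)"
  shows "\<exists>Q. (\<forall>i\<in>I. Q i \<subseteq> P i \<and> perfect_set (Q i)) \<and> (\<forall>S\<in>\<S>. decided \<F> Q S)"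
  using assms(2,3)
proof (induction \<S> rule: finite_induct)
  case empty
  then show ?case using assms(5) by (intro exI[of _ P]) auto
next
  case (insert S \<S>)
  then obtain Q where Q: "\<And>i. i \<in> I \<Longrightarrow> Q i \<subseteq> P i \<and> perfect_set (Q i)"
    "\<And>S. S \<in> \<S> \<Longrightarrow> decided \<F> Q S"
    by (metis insertCI)
  have S: "S \<noteq> {}" "S \<subseteq> I" using insert.prems by auto
  obtain R where R: "\<And>i. R i \<subseteq> Q i" "\<And>i. i \<in> S \<Longrightarrow> perfect_set (R i)"
    "\<And>i. i \<notin> S \<Longrightarrow> R i = Q i" "decided \<F> R S"
  proof (rule galvin_refine_single[OF assms(1), of S Q])
    show "finite S" using S assms(4) finite_subset by blast
    show "lex_below (Q i) (Q j)" if "i \<in> S" "j \<in> S" "i < j" for i j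
      using lex_below_mono[OF lex[of i j]] Q(1) S that by blast
  qed (use S Q in auto)
  show ?case
  proof (intro exI[of _ R] conjI ballI)
    fix i assume "i \<in> I"
    show "R i \<subseteq> P i" using R(1) Q(1) \<open>i \<in> I\<close> by blast
    show "perfect_set (R i)" using R(2,3) Q(1) \<open>i \<in> I\<close> by metis
  next
    fix S' assume "S' \<in> insert S \<S>"
    then show "decided \<F> R S'" using R(1,4) Q(2) decided_mono by blast
  qed
qed

text \<open>Level \<open>n\<close> of the binary tree is coded by \<open>{..<2 ^ n}\<close>, in lexicographic order; the parent
  of node \<open>i\<close> is \<open>i div 2\<close>.\<close>
definition galvin_level :: "cantor set set \<Rightarrow> nat \<Rightarrow> (nat \<Rightarrow> cantor set) \<Rightarrow> bool" where
  "galvin_level \<F> n P \<longleftrightarrow>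
     (\<forall>i<2 ^ n. perfect_set (P i)) \<and>
     (\<forall>i<2 ^ n. \<exists>x. P i \<subseteq> cylinder n x) \<and>
     (\<forall>i j. i < j \<and> j < 2 ^ n \<longrightarrow> lex_below (P i) (P j)) \<and>
     (\<forall>S. S \<noteq> {} \<and> S \<subseteq> {..<2 ^ n} \<longrightarrow> decided \<F> P S)"

text \<open>A level has only finitely many nonempty sets of nodes, so one refinement decides them
  all; order and the cylinder condition pass to subsets.\<close>

lemma galvin_level_refine:
  assumes "galvin_property \<F>"
    and "\<And>i. i < 2 ^ n \<Longrightarrow> perfect_set (P i)" "\<And>i. i < 2 ^ n \<Longrightarrow> \<exists>x. P i \<subseteq> cylinder n x"
    and lex: "\<And>i j. i < j \<Longrightarrow> j < 2 ^ n \<Longrightarrow> lex_below (P i) (P j)"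
  shows "\<exists>Q. galvin_level \<F> n Q \<and> (\<forall>i<2 ^ n. Q i \<subseteq> P i)"
proof -
  have "\<exists>Q. (\<forall>i\<in>{..<2 ^ n}. Q i \<subseteq> P i \<and> perfect_set (Q i)) \<and>
    (\<forall>S\<in>Pow {..<2 ^ n} - {{}}. decided \<F> Q S)"
    by (rule galvin_refine[OF assms(1)]) (use assms(2,4) in auto)
  then obtain Q where Q: "\<And>i. i < 2 ^ n \<Longrightarrow> Q i \<subseteq> P i \<and> perfect_set (Q i)"
    "\<And>S. S \<noteq> {} \<Longrightarrow> S \<subseteq> {..<2 ^ n} \<Longrightarrow> decided \<F> Q S"
    by (metis DiffI PowI lessThan_iff singletonD)
  have "lex_below (Q i) (Q j)" if "i < j" "j < 2 ^ n" for i j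
    using lex_below_mono[OF lex[OF that]] Q(1) that by simp
  moreover have "\<exists>x. Q i \<subseteq> cylinder n x" if "i < 2 ^ n" for i
    using assms(3) Q(1) that by (meson subset_trans)
  ultimately show ?thesis
    using Q by (intro exI[of _ Q]) (simp add: galvin_level_def)
qed

text \<open>Each node is split in two, the lower piece going to child \<open>2 * i\<close> and the
  upper one to child \<open>2 * i + 1\<close>; then the new level is refined.\<close>

lemma galvin_level_Suc:
  assumes "galvin_property \<F>" "galvin_level \<F> n P"
  shows "\<exists>Q. galvin_level \<F> (Suc n) Q \<and> (\<forall>i<2 ^ Suc n. Q i \<subseteq> P (i div 2))"
proof -
  have perf: "\<And>i. i < 2 ^ n \<Longrightarrow> perfect_set (P i)"
    and lex: "\<And>i j. i < j \<Longrightarrow> j < 2 ^ n \<Longrightarrow> lex_below (P i) (P j)"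
    using assms(2) by (auto simp: galvin_level_def)
  have "\<exists>R x. perfect_set (fst R) \<and> perfect_set (snd R) \<and> fst R \<subseteq> P i \<inter> cylinder (Suc n) x \<and>
      snd R \<subseteq> P i \<inter> cylinder (Suc n) x \<and> lex_below (fst R) (snd R)" if "i < 2 ^ n" for i
    by (rule perfect_set_split[OF perf[OF that], of "Suc n"]) (metis fst_conv snd_conv)
  then obtain R x where R: "\<And>i. i < 2 ^ n \<Longrightarrow> perfect_set (fst (R i)) \<and> perfect_set (snd (R i)) \<and>
      fst (R i) \<subseteq> P i \<inter> cylinder (Suc n) (x i) \<and> snd (R i) \<subseteq> P i \<inter> cylinder (Suc n) (x i) \<and>
      lex_below (fst (R i)) (snd (R i))"
    by metis
  define Q where "Q i = (if even i then fst (R (i div 2)) else snd (R (i div 2)))" for i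
  have half: "i div 2 < 2 ^ n" if "i < 2 ^ Suc n" for i :: nat
    using that by auto
  have sub: "Q i \<subseteq> P (i div 2)" if "i < 2 ^ Suc n" for i
    using R[OF half[OF that]] by (auto simp: Q_def)
  have "\<exists>Q'. galvin_level \<F> (Suc n) Q' \<and> (\<forall>i<2 ^ Suc n. Q' i \<subseteq> Q i)"
  proof (rule galvin_level_refine[OF assms(1)])
    fix i :: nat assume i: "i < 2 ^ Suc n"
    show "perfect_set (Q i)" using R[OF half[OF i]] by (simp add: Q_def)
    show "\<exists>x. Q i \<subseteq> cylinder (Suc n) x"
      using R[OF half[OF i]] by (intro exI[of _ "x (i div 2)"]) (auto simp: Q_def)
  next
    fix i j :: nat assume ij: "i < j" "j < 2 ^ Suc n"
    show "lex_below (Q i) (Q j)"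
    \<comment> \<open>Siblings are ordered by the split, other pairs by the order of their
      parents.\<close>
    proof (cases "i div 2 = j div 2")
      case True
      then have "even i" "odd j" using ij(1) by presburger+
      then show ?thesis using R[OF half[OF ij(2)]] True by (simp add: Q_def)
    next
      case False
      then have "i div 2 < j div 2" using ij(1) by linarith
      then show ?thesis
        using lex_below_mono[OF lex[OF _ half[OF ij(2)]] sub sub] ij by simp
    qed
  qed
  then show ?thesis using sub by (meson subset_trans)
qed

lemma galvin_scheme:
  assumes "galvin_property \<F>" "perfect_set P"
  obtains X where "\<And>n. galvin_level \<F> n (X n)" "X 0 0 \<subseteq> P"
    "\<And>n i. i < 2 ^ Suc n \<Longrightarrow> X (Suc n) i \<subseteq> X n (i div 2)"
proof -
  have "\<exists>X. \<forall>n. (galvin_level \<F> n (X n) \<and> (n = 0 \<longrightarrow> X n 0 \<subseteq> P)) \<and>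
     (\<forall>i<2 ^ Suc n. X (Suc n) i \<subseteq> X n (i div 2))"
  proof (rule dependent_nat_choice)
    \<comment> \<open>Level \<open>0\<close> has the single node \<open>0\<close>, and a cylinder of
      length \<open>0\<close> is the whole space, so \<open>P\<close> itself can be refined.\<close>
    show "\<exists>X. galvin_level \<F> 0 X \<and> (0 = 0 \<longrightarrow> X 0 \<subseteq> P)"
      using galvin_level_refine[OF assms(1), of 0 "\<lambda>_. P"] assms(2)
      by (auto simp: cylinder_def)
  qed (use galvin_level_Suc[OF assms(1)] in auto)
  then obtain X where "\<forall>n. (galvin_level \<F> n (X n) \<and> (n = 0 \<longrightarrow> X n 0 \<subseteq> P)) \<and>
     (\<forall>i<2 ^ Suc n. X (Suc n) i \<subseteq> X n (i div 2))" ..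
  then show thesis by (intro that[of X]) blast+
qed

section \<open>A perfect tree of positive limit density\<close>

text \<open>The cube is compact by Tychonoff. Countability of the index type makes the function
  space first countable, so the cube is sequentially compact.\<close>

lemma pointwise_convergent_subsequence:
  fixes f :: "nat \<Rightarrow> 'a::countable \<Rightarrow> real"
  assumes "\<And>j p. f j p \<in> {0..1}"
  obtains l r where "strict_mono r" "\<And>p. (\<lambda>j. f (r j) p) \<longlonglongrightarrow> l p"
proof -
  have "compactin (product_topology (\<lambda>_. euclidean) UNIV) (\<Pi>\<^sub>E p\<in>(UNIV :: 'a set). {0..1::real})"
    by (simp add: compactin_PiE compactin_euclidean_iff)
  then have "compact (\<Pi>\<^sub>E p\<in>(UNIV :: 'a set). {0..1::real})"
    by (simp add: euclidean_product_topology compactin_euclidean_iff)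
  then have "seq_compact (\<Pi>\<^sub>E p\<in>(UNIV :: 'a set). {0..1::real})"
    by (rule compact_imp_seq_compact)
  moreover have "\<forall>j. f j \<in> (\<Pi>\<^sub>E p\<in>(UNIV :: 'a set). {0..1::real})"
    using assms by auto
  ultimately obtain l r where lr: "strict_mono r" "(f \<circ> r) \<longlonglongrightarrow> l"
    unfolding seq_compact_def by metis
  have "(\<lambda>j. f (r j) p) \<longlonglongrightarrow> l p" for p
    using continuous_on_tendsto_compose[of UNIV "\<lambda>x. x p", OF _ lr(2)]
    by (simp add: continuous_on_product_coordinates)
  with lr(1) show thesis using that by blast
qed

lemma div_div_power2: "a div 2 ^ k div 2 = a div 2 ^ Suc k" for a k :: nat
  by (simp add: div_mult2_eq[symmetric] mult.commute)

text \<open>The descendants of node \<open>i\<close> that lie \<open>k\<close> levels deeper have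
  codes in an interval of length \<open>2 ^ k\<close>. This bounds densities by the uniform
  measure.\<close>

lemma finite_div_fibre: "finite {a::nat. a div 2 ^ k = i}"
  and card_div_fibre_le: "card {a::nat. a div 2 ^ k = i} \<le> 2 ^ k"
proof -
  have sub: "{a::nat. a div 2 ^ k = i} \<subseteq> {i * 2 ^ k..<i * 2 ^ k + 2 ^ k}"
    using dividend_less_div_times[of "2 ^ k"] by (auto simp: add.commute)
  then show "finite {a::nat. a div 2 ^ k = i}" using finite_subset by blast
  show "card {a::nat. a div 2 ^ k = i} \<le> 2 ^ k"
    using card_mono[OF _ sub] by simp
qed

text \<open>A subtree without dead ends in which every node eventually splits;
  \<open>a div 2 ^ k\<close> is the ancestor \<open>k\<close> levels up. The bound
  \<open>i < 2 ^ n\<close> on codes is imposed in \<open>branches\<close>.\<close>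

definition perfect_tree :: "(nat \<Rightarrow> nat \<Rightarrow> bool) \<Rightarrow> bool" where
  "perfect_tree T \<longleftrightarrow> T 0 0 \<and>
     (\<forall>n i. T n i \<longrightarrow> T (Suc n) (2 * i) \<or> T (Suc n) (2 * i + 1)) \<and>
     (\<forall>n i. T (Suc n) i \<longrightarrow> T n (i div 2)) \<and>
     (\<forall>n i. T n i \<longrightarrow> (\<exists>k a b. a \<noteq> b \<and> T (n + k) a \<and> T (n + k) b \<and>
        a div 2 ^ k = i \<and> b div 2 ^ k = i))"

text \<open>\<open>T\<close> holds at the nodes of positive limit density. Additivity of the limit
  gives children and parents, the bound \<open>1 / 2 ^ n\<close> forces splitting, and positivity at
  finitely many nodes already shows at a finite stage.\<close>

lemma positive_density_tree:
  fixes A :: "nat \<Rightarrow> nat set" and \<epsilon> :: real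
  assumes "\<epsilon> > 0" and A: "\<And>j. A j \<subseteq> {..<2 ^ j}" and dens: "\<And>j. \<epsilon> * 2 ^ j \<le> card (A j)"
  obtains T where "perfect_tree T"
    "\<forall>n S. finite S \<and> (\<forall>i\<in>S. T n i) \<longrightarrow>
      (\<exists>j\<ge>n. \<forall>i\<in>S. \<exists>a\<in>A j. a div 2 ^ (j - n) = i)"
proof -
  define B where "B j n i = {a\<in>A j. a div 2 ^ (j - n) = i}" for j n i
  \<comment> \<open>Dividing by \<open>2 ^ j\<close>, not by \<open>card (A j)\<close>, keeps the
    density below the uniform measure. The default \<open>0\<close> for \<open>n > j\<close> is
    invisible in the limit.\<close>
  define d where "d j = (\<lambda>(n, i). if n \<le> j then real (card (B j n i)) / 2 ^ j else 0)" for j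
  have finA: "finite (A j)" for j using A finite_subset by blast
  have finB: "finite (B j n i)" for j n i using finA by (simp add: B_def)
  have cardB: "card (B j n i) \<le> 2 ^ (j - n)" for j n i
  proof -
    have "card (B j n i) \<le> card {a::nat. a div 2 ^ (j - n) = i}"
      by (rule card_mono[OF finite_div_fibre]) (auto simp: B_def)
    then show ?thesis using card_div_fibre_le le_trans by blast
  qed
  have d_le: "d j (n, i) \<le> 1 / 2 ^ n" for j n i
  proof (cases "n \<le> j")
    case True
    have "real (card (B j n i)) \<le> 2 ^ (j - n)"
      using cardB[of j n i] by (metis of_nat_le_iff of_nat_numeral of_nat_power)
    then show ?thesis using True by (simp add: d_def field_simps power_diff)
  qed (simp add: d_def)
  have "d j p \<in> {0..1}" for j p
  proof -
    obtain n i where p: "p = (n, i)" by (cases p)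
    have "(1::real) / 2 ^ n \<le> 1" by simp
    then have "d j p \<le> 1" using d_le[of j n i] unfolding p by (rule order_trans[rotated])
    then show ?thesis by (auto simp: d_def p)
  qed
  then obtain l r where r: "strict_mono r" and lim: "\<And>p. (\<lambda>j. d (r j) p) \<longlonglongrightarrow> l p"
    using pointwise_convergent_subsequence by blast
  have r_ge: "\<forall>\<^sub>F j in sequentially. n \<le> r j" for n
    using filterlim_subseq[OF r] by (simp add: filterlim_at_top)
  have l_nonneg: "0 \<le> l p" for p
    by (rule LIMSEQ_le_const[OF lim]) (auto simp: d_def split: prod.splits)
  have l_le: "l (n, i) \<le> 1 / 2 ^ n" for n i
    by (rule LIMSEQ_le_const2[OF lim]) (use d_le in auto)
  \<comment> \<open>All of \<open>A j\<close> lies below the root, so the root has density at least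
    \<open>\<epsilon>\<close> at every stage.\<close>
  have l_root: "\<epsilon> \<le> l (0, 0)"
  proof (rule LIMSEQ_le_const[OF lim])
    have "B j 0 0 = A j" for j using A[of j] by (auto simp: B_def)
    then show "\<exists>N. \<forall>j\<ge>N. \<epsilon> \<le> d (r j) (0, 0)"
      using dens by (auto simp: d_def field_simps)
  qed
  \<comment> \<open>The condition \<open>Suc n \<le> j\<close> keeps all three values off the
    default \<open>0\<close>; it holds eventually along \<open>r\<close>, so additivity passes to
    the limit.\<close>
  have d_add: "d j (n, i) = d j (Suc n, 2 * i) + d j (Suc n, 2 * i + 1)" if "Suc n \<le> j" for j n i
  proof -
    have "a div 2 ^ (j - n) = a div 2 ^ (j - Suc n) div 2" for a :: nat
      using that by (simp only: div_div_power2 Suc_diff_Suc[of n j] Suc_le_eq)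
    then have "B j n i = B j (Suc n) (2 * i) \<union> B j (Suc n) (2 * i + 1)"
      by (auto simp: B_def)
    moreover have "B j (Suc n) (2 * i) \<inter> B j (Suc n) (2 * i + 1) = {}"
      by (auto simp: B_def)
    ultimately have "card (B j n i) = card (B j (Suc n) (2 * i)) + card (B j (Suc n) (2 * i + 1))"
      using card_Un_disjoint finB by metis
    then show ?thesis using that by (simp add: d_def field_simps)
  qed
  have l_add: "l (n, i) = l (Suc n, 2 * i) + l (Suc n, 2 * i + 1)" for n i
  proof (rule LIMSEQ_unique[OF lim])
    have "(\<lambda>j. d (r j) (Suc n, 2 * i) + d (r j) (Suc n, 2 * i + 1))
        \<longlonglongrightarrow> l (Suc n, 2 * i) + l (Suc n, 2 * i + 1)"
      by (intro tendsto_add lim)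
    then show "(\<lambda>j. d (r j) (n, i)) \<longlonglongrightarrow> l (Suc n, 2 * i) + l (Suc n, 2 * i + 1)"
      by (rule Lim_transform_eventually)
        (use r_ge[of "Suc n"] in \<open>eventually_elim, simp add: d_add\<close>)
  qed
  show thesis
  proof (rule that[of "\<lambda>n i. l (n, i) > 0"];
      (unfold perfect_tree_def)?; intro conjI allI impI; (elim conjE)?)
    show "l (0, 0) > 0" using l_root \<open>\<epsilon> > 0\<close> by linarith
  next
    fix n i assume "l (n, i) > 0"
    then show "l (Suc n, 2 * i) > 0 \<or> l (Suc n, 2 * i + 1) > 0"
      using l_add[of n i] by linarith
  next
    fix n i assume i: "l (Suc n, i) > 0"
    consider "i = 2 * (i div 2)" | "i = 2 * (i div 2) + 1" by linarith
    then show "l (n, i div 2) > 0"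
      using i l_add[of n "i div 2"] l_nonneg[of "(Suc n, 2 * (i div 2))"]
        l_nonneg[of "(Suc n, 2 * (i div 2) + 1)"] by cases (smt (verit))+
  next
    fix n i assume pos: "l (n, i) > 0"
    show "\<exists>k a b. a \<noteq> b \<and> l (n + k, a) > 0 \<and> l (n + k, b) > 0 \<and> a div 2 ^ k = i \<and> b div 2 ^ k = i"
    proof (rule ccontr)
      assume *: "\<not> ?thesis"
      \<comment> \<open>Without splitting, the whole mass of \<open>i\<close> moves to a single
        descendant on each level, contradicting the bound \<open>1 / 2 ^ (n + k)\<close> for large
        \<open>k\<close>.\<close>
      have "\<exists>a. a div 2 ^ k = i \<and> l (n + k, a) = l (n, i)" for k
      proof (induction k)
        case (Suc k)
        then obtain a where a: "a div 2 ^ k = i" "l (n + k, a) = l (n, i)" by blast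
        have div: "(2 * a) div 2 ^ Suc k = i" "(2 * a + 1) div 2 ^ Suc k = i"
          using a(1) by (simp_all add: div_mult2_eq)
        have "\<not> (l (n + Suc k, 2 * a) > 0 \<and> l (n + Suc k, 2 * a + 1) > 0)"
        proof
          assume "l (n + Suc k, 2 * a) > 0 \<and> l (n + Suc k, 2 * a + 1) > 0"
          moreover have "2 * a \<noteq> 2 * a + 1" by simp
          ultimately show False using * div by blast
        qed
        then have "l (n + Suc k, 2 * a) = l (n, i) \<or> l (n + Suc k, 2 * a + 1) = l (n, i)"
          using l_add[of "n + k" a] a(2) l_nonneg[of "(n + Suc k, 2 * a)"]
            l_nonneg[of "(n + Suc k, 2 * a + 1)"] by (smt (verit) add_Suc_right)
        then show ?case using div by blast
      qed simp
      then have "l (n, i) \<le> 1 / 2 ^ (n + k)" for k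
        using l_le by metis
      moreover obtain k where "(1 / 2) ^ k < l (n, i)"
        using real_arch_pow_inv[OF pos, of "1/2"] by auto
      moreover have "(1 / 2 :: real) ^ (n + k) \<le> (1 / 2) ^ k"
        by (rule power_decreasing) auto
      ultimately show False by (smt (verit) power_one_over)
    qed
  next
    fix n and S :: "nat set" assume S: "finite S" "\<forall>i\<in>S. l (n, i) > 0"
    have "\<forall>\<^sub>F j in sequentially. \<forall>i\<in>S. d (r j) (n, i) > 0"
      using S by (auto intro!: eventually_ball_finite order_tendstoD(1)[OF lim])
    then have "\<forall>\<^sub>F j in sequentially. n \<le> r j \<and> (\<forall>i\<in>S. d (r j) (n, i) > 0)"
      using r_ge by (simp add: eventually_conj_iff)
    then obtain j where j: "n \<le> r j" "\<forall>i\<in>S. d (r j) (n, i) > 0"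
      using eventually_happens' sequentially_bot by blast
    have "\<exists>a\<in>A (r j). a div 2 ^ (r j - n) = i" if "i \<in> S" for i
    proof -
      have "B (r j) n i \<noteq> {}" using j that by (force simp: d_def)
      then show ?thesis by (auto simp: B_def)
    qed
    then show "\<exists>j\<ge>n. \<forall>i\<in>S. \<exists>a\<in>A j. a div 2 ^ (j - n) = i"
      using j(1) by blast
  qed
qed

section \<open>The branches of a subtree\<close>

text \<open>Paths stay implicit: as an intersection of finite unions of closed sets, this is visibly
  closed.\<close>

definition branches :: "(nat \<Rightarrow> nat \<Rightarrow> 'a set) \<Rightarrow> (nat \<Rightarrow> nat \<Rightarrow> bool) \<Rightarrow> 'a set" where
  "branches X T = (\<Inter>n. \<Union>i\<in>{i. i < 2 ^ n \<and> T n i}. X n i)"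

lemma scheme_antimono:
  fixes X :: "nat \<Rightarrow> nat \<Rightarrow> 'a set"
  assumes "\<And>n i. i < 2 ^ Suc n \<Longrightarrow> X (Suc n) i \<subseteq> X n (i div 2)" "i < 2 ^ (n + k)"
  shows "X (n + k) i \<subseteq> X n (i div 2 ^ k)"
  using assms(2)
proof (induction k arbitrary: i)
  case (Suc k)
  have "i div 2 < 2 ^ (n + k)" using Suc.prems by (simp add: less_mult_imp_div_less mult.commute)
  then have "X (n + k) (i div 2) \<subseteq> X n (i div 2 div 2 ^ k)" by (rule Suc.IH)
  also have "i div 2 div 2 ^ k = i div 2 ^ Suc k" by (simp add: div_mult2_eq)
  finally show ?case using assms(1)[of i "n + k"] Suc.prems by auto
qed simp

text \<open>From node \<open>i\<close>, children in \<open>T\<close> are followed downwards; the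
  nested closed sets met on the way have a common point by compactness. Levels above
  \<open>n\<close> are covered by the ancestors of \<open>i\<close>.\<close>

lemma branch_through_node:
  fixes X :: "nat \<Rightarrow> nat \<Rightarrow> cantor set"
  assumes closed: "\<And>n i. i < 2 ^ n \<Longrightarrow> closed (X n i) \<and> X n i \<noteq> {}"
    and anti: "\<And>n i. i < 2 ^ Suc n \<Longrightarrow> X (Suc n) i \<subseteq> X n (i div 2)"
    and tree: "perfect_tree T"
    and i: "i < 2 ^ n" "T n i"
  shows "\<exists>x. x \<in> branches X T \<inter> X n i"
proof -
  have up: "T (Suc m) (2 * a) \<or> T (Suc m) (2 * a + 1)" if "T m a" for m a
    using tree that by (simp add: perfect_tree_def)
  have down: "T m (a div 2)" if "T (Suc m) a" for m a
    using tree that by (simp add: perfect_tree_def)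
  have "\<exists>g. \<forall>k. (g k < 2 ^ (n + k) \<and> T (n + k) (g k) \<and> (k = 0 \<longrightarrow> g k = i)) \<and> g (Suc k) div 2 = g k"
  proof (rule dependent_nat_choice)
    fix a k assume a: "a < 2 ^ (n + k) \<and> T (n + k) a \<and> (k = 0 \<longrightarrow> a = i)"
    then show "\<exists>b. (b < 2 ^ (n + Suc k) \<and> T (n + Suc k) b \<and> (Suc k = 0 \<longrightarrow> b = i)) \<and> b div 2 = a"
      using up[of "n + k" a]
      by (auto intro: exI[of _ "2 * a"] exI[of _ "2 * a + 1"])
  qed (use i in auto)
  then obtain g where g: "\<And>k. g k < 2 ^ (n + k)" "\<And>k. T (n + k) (g k)" "g 0 = i"
    "\<And>k. g (Suc k) div 2 = g k" by blast
  have "(\<Inter>k. X (n + k) (g k)) \<noteq> {}"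
  proof (rule cantor_nested_Inter_nonempty)
    fix k
    show "closed (X (n + k) (g k))" "X (n + k) (g k) \<noteq> {}" using closed g(1) by auto
    show "X (n + Suc k) (g (Suc k)) \<subseteq> X (n + k) (g k)"
      using anti[of "g (Suc k)" "n + k"] g(1)[of "Suc k"] g(4)[of k] by simp
  qed
  then obtain x where x: "\<And>k. x \<in> X (n + k) (g k)" by blast
  have anc: "T m (a div 2 ^ k)" if "T (m + k) a" for m k a
    using that
  proof (induction k arbitrary: a)
    case (Suc k)
    then have "T m (a div 2 div 2 ^ k)" using down by simp
    then show ?case by (simp add: div_mult2_eq)
  qed simp
  have "\<exists>a<2 ^ m. T m a \<and> x \<in> X m a" for m
  proof (cases "n \<le> m")
    case True
    then show ?thesis using g(1,2)[of "m - n"] x[of "m - n"] by auto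
  next
    case False
    then have n: "m + (n - m) = n" by simp
    have "i div 2 ^ (n - m) < 2 ^ m"
      using i(1) n by (metis less_mult_imp_div_less power_add)
    moreover have "x \<in> X m (i div 2 ^ (n - m))"
      using scheme_antimono[of X i m "n - m", OF anti] i(1) n x[of 0] g(3) by auto
    ultimately show ?thesis using anc[of m "n - m" i] n i(2) by auto
  qed
  then have "x \<in> branches X T" by (auto simp: branches_def)
  then show ?thesis using x[of 0] g(3) by auto
qed

text \<open>The node of \<open>x\<close> on level \<open>n\<close> has two distinct descendants in
  \<open>T\<close>, each carrying a branch. Both branches share the cylinder of length
  \<open>n\<close> with \<open>x\<close>, and at least one differs from \<open>x\<close>.\<close>

lemma perfect_set_branches:
  fixes X :: "nat \<Rightarrow> nat \<Rightarrow> cantor set"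
  assumes closed: "\<And>n i. i < 2 ^ n \<Longrightarrow> closed (X n i) \<and> X n i \<noteq> {}"
    and small: "\<And>n i. i < 2 ^ n \<Longrightarrow> \<exists>x. X n i \<subseteq> cylinder n x"
    and disj: "\<And>n i j. i < 2 ^ n \<Longrightarrow> j < 2 ^ n \<Longrightarrow> i \<noteq> j \<Longrightarrow> X n i \<inter> X n j = {}"
    and anti: "\<And>n i. i < 2 ^ Suc n \<Longrightarrow> X (Suc n) i \<subseteq> X n (i div 2)"
    and tree: "perfect_tree T"
  shows "perfect_set (branches X T)"
  unfolding perfect_set_cylinder_iff
proof (intro conjI ballI allI)
  have thr: "\<exists>x. x \<in> branches X T \<inter> X n i" if "i < 2 ^ n" "T n i" for n i
    using branch_through_node[of X T i n] closed anti tree that by blast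
  show "branches X T \<noteq> {}" using thr[of 0 0] tree by (auto simp: perfect_tree_def)
  show "closed (branches X T)"
    unfolding branches_def by (intro closed_INT closed_UN ballI) (use closed in auto)
  fix x n assume x: "x \<in> branches X T"
  then obtain i where i: "i < 2 ^ n" "T n i" "x \<in> X n i" by (auto simp: branches_def)
  obtain k a b where ab: "a \<noteq> b" "T (n + k) a" "T (n + k) b" "a div 2 ^ k = i" "b div 2 ^ k = i"
    using tree i(2) unfolding perfect_tree_def by blast
  have lt: "c < 2 ^ (n + k)" if "c div 2 ^ k = i" for c
    using that i(1) by (metis div_less_iff_less_mult power_add zero_less_numeral zero_less_power)
  obtain u where u: "u \<in> branches X T" "u \<in> X (n + k) a" using thr[OF lt[OF ab(4)] ab(2)] by blast
  obtain v where v: "v \<in> branches X T" "v \<in> X (n + k) b" using thr[OF lt[OF ab(5)] ab(3)] by blast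
  have "u \<noteq> v" using disj[OF lt[OF ab(4)] lt[OF ab(5)] ab(1)] u(2) v(2) by auto
  have X: "u \<in> X n i" "v \<in> X n i"
    using scheme_antimono[of X a n k, OF anti lt[OF ab(4)]] ab(4) u(2)
      scheme_antimono[of X b n k, OF anti lt[OF ab(5)]] ab(5) v(2) by auto
  then have "u \<in> cylinder n x" "v \<in> cylinder n x"
    using small[OF i(1)] i(3) by (auto simp: cylinder_def)
  then show "\<exists>y\<in>branches X T \<inter> cylinder n x. y \<noteq> x"
    using u(1) v(1) \<open>u \<noteq> v\<close> by (intro bexI[of _ "if u = x then v else u"]) auto
qed

lemma finite_set_separated:
  fixes F :: "cantor set"
  assumes "finite F"
  obtains n where "\<And>x y. x \<in> F \<Longrightarrow> y \<in> F \<Longrightarrow> y \<in> cylinder n x \<Longrightarrow> x = y"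
proof -
  have "\<exists>k. \<forall>n\<ge>k. y \<in> cylinder n x \<longrightarrow> x = y" for x y
  proof (cases "x = y")
    case False
    then obtain k where "x k \<noteq> y k" by auto
    then show ?thesis by (intro exI[of _ "Suc k"]) (auto simp: cylinder_def)
  qed auto
  then have "\<forall>\<^sub>F n in sequentially. y \<in> cylinder n x \<longrightarrow> x = y" for x y
    unfolding eventually_sequentially by blast
  then have "\<forall>\<^sub>F n in sequentially. \<forall>x\<in>F. \<forall>y\<in>F. y \<in> cylinder n x \<longrightarrow> x = y"
    using assms by (intro eventually_ball_finite ballI) auto
  then obtain n where "\<forall>x\<in>F. \<forall>y\<in>F. y \<in> cylinder n x \<longrightarrow> x = y"
    using eventually_happens' sequentially_bot by blast
  then show thesis using that by blast
qed

text \<open>On a level \<open>n\<close> whose cylinders separate the points of \<open>F\<close>,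
  these points lie in distinct nodes, so \<open>F\<close> is a transversal of a set of nodes in
  \<open>T\<close>.\<close>

lemma fin_subsets_branches:
  fixes X :: "nat \<Rightarrow> nat \<Rightarrow> cantor set"
  assumes small: "\<And>n i. i < 2 ^ n \<Longrightarrow> \<exists>x. X n i \<subseteq> cylinder n x"
    and transversal: "\<And>n S x. S \<noteq> {} \<Longrightarrow> S \<subseteq> {..<2 ^ n} \<Longrightarrow> \<forall>i\<in>S. T n i \<and> x i \<in> X n i \<Longrightarrow> x ` S \<in> \<F>"
  shows "fin_subsets (branches X T) \<subseteq> \<F>"
proof
  fix F assume "F \<in> fin_subsets (branches X T)"
  then have F: "F \<subseteq> branches X T" "finite F" "F \<noteq> {}" by (auto simp: mem_fin_subsets_iff)
  obtain n where n: "\<And>x y. x \<in> F \<Longrightarrow> y \<in> F \<Longrightarrow> y \<in> cylinder n x \<Longrightarrow> x = y"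
    using finite_set_separated[OF F(2)] by blast
  have "\<forall>x\<in>F. \<exists>i<2 ^ n. T n i \<and> x \<in> X n i"
  proof
    fix x assume "x \<in> F"
    then have "x \<in> (\<Union>i\<in>{i. i < 2 ^ n \<and> T n i}. X n i)"
      using F(1) unfolding branches_def by blast
    then show "\<exists>i<2 ^ n. T n i \<and> x \<in> X n i" by blast
  qed
  then obtain h where h: "\<And>x. x \<in> F \<Longrightarrow> h x < 2 ^ n \<and> T n (h x) \<and> x \<in> X n (h x)"
    by metis
  have inj: "inj_on h F"
  proof (rule inj_onI)
    fix x y assume xy: "x \<in> F" "y \<in> F" "h x = h y"
    then have "x \<in> X n (h x)" "y \<in> X n (h x)" "h x < 2 ^ n" using h by metis+
    then have "y \<in> cylinder n x" using small[of "h x" n] by (auto simp: cylinder_def)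
    then show "x = y" using n xy by blast
  qed
  have "inv_into F h ` h ` F \<in> \<F>"
    by (rule transversal[of _ n]) (use F(3) h inj in \<open>auto simp: inv_into_f_f\<close>)
  then show "F \<in> \<F>" using inj by (simp add: inv_into_image_cancel)
qed

section \<open>Construction of the perfect subset\<close>

lemma filling_perfect_subset:
  fixes \<epsilon> :: real and \<F> :: "cantor set set"
  assumes "\<epsilon> > 0" "filling \<epsilon> \<F>" "galvin_property \<F>" "perfect_set P"
  obtains Q where "Q \<subseteq> P" "perfect_set Q" "fin_subsets Q \<subseteq> \<F>"
proof -
  obtain X where level: "\<And>n. galvin_level \<F> n (X n)" and X0: "X 0 0 \<subseteq> P"
    and anti: "\<And>n i. i < 2 ^ Suc n \<Longrightarrow> X (Suc n) i \<subseteq> X n (i div 2)"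
    using galvin_scheme[OF assms(3,4)] by blast
  have closed: "closed (X n i) \<and> X n i \<noteq> {}" and small: "\<exists>x. X n i \<subseteq> cylinder n x" if "i < 2 ^ n" for n i
    using level[of n] that by (auto simp: galvin_level_def perfect_set_def)
  have disj: "X n i \<inter> X n j = {}" if "i < 2 ^ n" "j < 2 ^ n" "i \<noteq> j" for n i j
  proof -
    have "lex_below (X n i) (X n j) \<or> lex_below (X n j) (X n i)"
      using level[of n] that by (cases i j rule: linorder_cases) (auto simp: galvin_level_def)
    then show ?thesis using less_fun_irrefl by (auto simp: lex_below_def)
  qed
  define p where "p n i = (SOME x. x \<in> X n i)" for n i
  have p: "p n i \<in> X n i" if "i < 2 ^ n" for n i
    using closed[OF that] by (simp add: p_def some_in_eq)
  \<comment> \<open>Injectivity turns the filling bound for points into one for node codes.\<close>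
  have inj: "inj_on (p n) {..<2 ^ n}" for n
  proof (rule inj_onI, rule ccontr)
    fix i j :: nat assume ij: "i \<in> {..<2 ^ n}" "j \<in> {..<2 ^ n}" "p n i = p n j" "i \<noteq> j"
    then have "p n i \<in> X n i \<inter> X n j" using p[of i n] p[of j n] by simp
    then show False using disj[of i n j] ij by auto
  qed
  have "\<forall>j. \<exists>A. A \<subseteq> {..<2 ^ j} \<and> p j ` A \<in> \<F> \<and> \<epsilon> * 2 ^ j \<le> card A"
  proof
    fix j
    have "p j ` {..<2 ^ j} \<in> fin_subsets UNIV"
      by (simp add: mem_fin_subsets_iff lessThan_empty_iff)
    then obtain G where G: "G \<subseteq> p j ` {..<2 ^ j}" "G \<in> \<F>"
      "real (card G) \<ge> \<epsilon> * real (card (p j ` {..<2 ^ j}))"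
      using assms(2) unfolding filling_def by blast
    from G(1) obtain A where A: "A \<subseteq> {..<2 ^ j}" "G = p j ` A" by (rule subset_imageE)
    have "card G = card A" unfolding A(2) by (rule card_image[OF inj_on_subset[OF inj A(1)]])
    then show "\<exists>A. A \<subseteq> {..<2 ^ j} \<and> p j ` A \<in> \<F> \<and> \<epsilon> * 2 ^ j \<le> card A"
      using A G by (auto simp: card_image[OF inj])
  qed
  then obtain A where "\<forall>j. A j \<subseteq> {..<2 ^ j} \<and> p j ` A j \<in> \<F> \<and> \<epsilon> * 2 ^ j \<le> card (A j)"
    by (rule choice[THEN exE])
  then have A: "A j \<subseteq> {..<2 ^ j}" "p j ` A j \<in> \<F>" "\<epsilon> * 2 ^ j \<le> card (A j)" for j
    by simp_all
  obtain T where T: "perfect_tree T"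
    and T_A: "\<forall>n S. finite S \<and> (\<forall>i\<in>S. T n i) \<longrightarrow>
      (\<exists>j\<ge>n. \<forall>i\<in>S. \<exists>a\<in>A j. a div 2 ^ (j - n) = i)"
    by (rule positive_density_tree[OF assms(1) A(1,3)])
  have transversal: "x ` S \<in> \<F>"
    if S: "S \<noteq> {}" "S \<subseteq> {..<2 ^ n}" "\<forall>i\<in>S. T n i \<and> x i \<in> X n i" for n S x
  proof -
    have "finite S" using S(2) finite_subset by blast
    then obtain j where j: "n \<le> j" "\<forall>i\<in>S. \<exists>a\<in>A j. a div 2 ^ (j - n) = i"
      using T_A S(3) by blast
    from bchoice[OF j(2)[unfolded Bex_def]] obtain a
      where a: "\<And>i. i \<in> S \<Longrightarrow> a i \<in> A j \<and> a i div 2 ^ (j - n) = i"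
      by blast
    have "(\<lambda>i. p j (a i)) ` S \<subseteq> p j ` A j" using a by auto
    then have "(\<lambda>i. p j (a i)) ` S \<in> \<F>"
      using A(2)[of j] assms(2) S(1) unfolding filling_def hereditary_def by blast
    moreover have "p j (a i) \<in> X n i" if "i \<in> S" for i
    proof -
      have "a i < 2 ^ j" using a[OF that] A(1)[of j] by auto
      then show ?thesis
        using scheme_antimono[of X "a i" n "j - n", OF anti] p[of "a i" j] a[OF that] j(1) by auto
    qed
    moreover have "decided \<F> (X n) S" using level[of n] S by (simp add: galvin_level_def)
    \<comment> \<open>The points \<open>p j (a i)\<close> form one transversal in
      \<open>\<F>\<close>, which excludes the negative alternative of
      \<open>decided\<close>.\<close>
    ultimately have "\<forall>y. (\<forall>i\<in>S. y i \<in> X n i) \<longrightarrow> y ` S \<in> \<F>"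
      unfolding decided_def by (auto dest: spec[of _ "\<lambda>i. p j (a i)"])
    then show ?thesis using S(3) by simp
  qed
  show thesis
  proof (rule that)
    \<comment> \<open>The only node on level \<open>0\<close> is \<open>0\<close>, so every branch
      lies in \<open>X 0 0\<close>.\<close>
    show "branches X T \<subseteq> P" using X0 by (fastforce simp: branches_def dest!: spec[of _ 0])
    show "perfect_set (branches X T)"
      by (rule perfect_set_branches) (fact closed small disj anti T)+
    show "fin_subsets (branches X T) \<subseteq> \<F>"
      by (rule fin_subsets_branches) (fact small transversal)+
  qed
qed

theorem theorem2:
  fixes \<epsilon> :: real and \<F> :: "cantor set set"
  assumes "\<epsilon> > 0"
    and "\<F> \<subseteq> fin_subsets UNIV"
    and "filling \<epsilon> \<F>"
    and "galvin_property \<F>"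
  shows "\<forall>P. perfect_set P \<longrightarrow> (\<exists>Q\<subseteq>P. perfect_set Q \<and> fin_subsets Q \<subseteq> \<F>)"
proof (intro allI impI)
  fix P :: "cantor set" assume "perfect_set P"
  with assms(1,3,4) obtain Q where "Q \<subseteq> P" "perfect_set Q" "fin_subsets Q \<subseteq> \<F>"
    by (rule filling_perfect_subset)
  then show "\<exists>Q\<subseteq>P. perfect_set Q \<and> fin_subsets Q \<subseteq> \<F>"
    by (intro exI[of _ Q]) simp
qed

end
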